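(* Suppose that a pattern $p$ uses $r$ distinct variables, where the $j$th variable occurs $k_j\ge 1$ times. Without loss of generality, let $k=|p|=k_1+\cdots+k_r$ and $1=k_1=\cdots=k_s<k_{s+1}\le\cdots\le k_r$. Then the mean number of occurrences of $p$ in a partial word of length $n$ over an alphabet of $m$ letters is $$\widehat{\Omega}_n\sim\frac{n^{s+1}}{(s+1)!}\prod_{j=s+1}^r\frac{m2^{k_j}-m+1}{(m+1)^{k_j}-(m2^{k_j}-m+1)}.$$
   Context: A partial word over an alphabet $\mathcal A$ is a sequence of characters from $\mathcal A\cup\{\diamond\}$, where $\diamond\notin\mathcal A$ is the hole character (full words, with no holes, are included). Two partial words $u=u_1\cdots u_N$ and $v=v_1\cdots v_N$ of equal length are compatible, written $u\uparrow v$, if $u_i=v_i$ whenever $u_i,v_i\in\mathcal A$. A pattern is a word $p$ over an alphabet $\mathcal V$ of variables, and $|p|$ is its length; a morphism $h:\mathcal V^*\to\mathcal A^*$ is nonerasing if $h(v)$ is nonempty for every $v\in\mathcal V$. A factor is a contiguous block. Occurrences are counted as follows: a partial word $w$ over $\mathcal A$ encounters $p$ a total of $N>0$ times if, for some maximal $M>0$, there exist $M$ distinct nonerasing morphisms $h_i:\mathcal V^*\to\mathcal A^*$ such that for some $t_1,\ldots,t_M>0$ there are $t_i>0$ factors $f_i$ of $w$ that satisfy $f_i\uparrow h_i(p)$, and $\sum_{i=1}^M t_i=N$ (factors are counted by position in $w$). The mean is over all $(m+1)^n$ partial words of length $n$ over an alphabet $\mathcal A$ of $m$ letters. The notation $\sim$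 means that the ratio of the two sides tends to $1$ as $n\to\infty$. Empty products equal $1$.
   Formalization: Morphisms matching the same factor with equal block lengths |h(v)| count as one occurrence (counting each separately makes the claim false, e.g. p=x, m≥2 gives exponential growth); m≥1 is assumed, and m≥2 if some variable repeats, since for m=1 the denominator is 0. *)

theory Defs
  imports Complex_Main "HOL-Library.FuncSet" "HOL-Library.Landau_Symbols"
begin

text \<open>A partial word is a list over \<open>'a option\<close>, where \<open>None\<close> is the hole character.\<close>

definition partial_words :: "'a set \<Rightarrow> nat \<Rightarrow> 'a option list set" where
  "partial_words A n = {w. set w \<subseteq> insert None (Some ` A) \<and> length w = n}"

definition compatible :: "'a option list \<Rightarrow> 'a option list \<Rightarrow> bool" where
  "compatible u v \<longleftrightarrow> list_all2 (\<lambda>x y. x \<noteq> None \<longrightarrow> y \<noteq> None \<longrightarrow> x = y) u v"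

text \<open>
  A morphism is given by its values on the variables that occur in the pattern, as an extensional
  function, so that distinct functions are distinct morphisms.
\<close>

definition nonerasing_morphisms :: "'v set \<Rightarrow> 'a set \<Rightarrow> ('v \<Rightarrow> 'a list) set" where
  "nonerasing_morphisms V A = V \<rightarrow>\<^sub>E {u. u \<noteq> [] \<and> set u \<subseteq> A}"

definition apply_morphism :: "('v \<Rightarrow> 'a list) \<Rightarrow> 'v list \<Rightarrow> 'a list" where
  "apply_morphism h p = concat (map h p)"

definition factor :: "'b list \<Rightarrow> nat \<Rightarrow> nat \<Rightarrow> 'b list" where
  "factor w i l = take l (drop i w)"

text \<open>
  All pairs of a nonerasing morphism \<open>h\<close> and a factor of \<open>w\<close>, given by its position \<open>i\<close> and its
  length \<open>l\<close>, that is compatible with \<open>h(p)\<close>.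
\<close>

definition encounters ::
    "'a set \<Rightarrow> 'a option list \<Rightarrow> 'v list \<Rightarrow> (('v \<Rightarrow> 'a list) \<times> nat \<times> nat) set" where
  "encounters A w p = {(h, i, l). h \<in> nonerasing_morphisms (set p) A \<and> i + l \<le> length w \<and>
     compatible (factor w i l) (map Some (apply_morphism h p))}"

text \<open>
  If a factor has holes, several morphisms may match it with the same division into blocks (the
  images of the variables), differing only in the letters they supply for holes. They constitute
  one and the same occurrence: an occurrence consists of a position \<open>i\<close> and the block lengths
  \<open>|h(v)|\<close>. Counting every such morphism separately would make the mean number of occurrences of a
  single variable at least \<open>(2m/(m+1))^n\<close>, which is exponential for \<open>m \<ge> 2\<close>. For words without holes there is no
  difference; see \<open>num_occurrences_full_word\<close> below.
\<close>

definition occurrences :: "'a set \<Rightarrow> 'a option list \<Rightarrow> 'v list \<Rightarrow> (nat \<times> ('v \<Rightarrow> nat)) set" where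
  "occurrences A w p = (\<lambda>(h, i, l). (i, \<lambda>v\<in>set p. length (h v))) ` encounters A w p"

definition num_occurrences :: "'a set \<Rightarrow> 'a option list \<Rightarrow> 'v list \<Rightarrow> nat" where
  "num_occurrences A w p = card (occurrences A w p)"

definition mean_occurrences :: "'a set \<Rightarrow> 'v list \<Rightarrow> nat \<Rightarrow> real" where
  "mean_occurrences A p n =
     (\<Sum>w\<in>partial_words A n. real (num_occurrences A w p)) / real (card (partial_words A n))"

lemma card_partial_words:
  assumes "finite A"
  shows "card (partial_words A n) = (card A + 1) ^ n"
proof -
  have "card (insert None (Some ` A)) = card A + 1"
    using assms by (subst card_insert_disjoint) (auto simp: card_image)
  with card_lists_length_eq[of "insert None (Some ` A)" n] assms show ?thesis
    by (simp add: partial_words_def)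
qed

lemma compatible_map_Some: "compatible (map Some u) (map Some v) \<longleftrightarrow> u = v"
  by (auto simp: compatible_def list_all2_conv_all_nth list_eq_iff_nth_eq)

lemma apply_morphism_inj:
  assumes "apply_morphism h p = apply_morphism h' p"
    and "\<And>v. v \<in> set p \<Longrightarrow> length (h v) = length (h' v)"
  shows "\<forall>v\<in>set p. h v = h' v"
  using assms by (induction p) (auto simp: apply_morphism_def)

lemma finite_encounters:
  assumes "finite A"
  shows "finite (encounters A w p)"
proof -
  let ?n = "length w"
  let ?U = "{u. set u \<subseteq> A \<and> length u \<le> ?n}"
  have "encounters A w p \<subseteq> (set p \<rightarrow>\<^sub>E ?U) \<times> {..?n} \<times> {..?n}"
  proof clarify
    fix h i l assume *: "(h, i, l) \<in> encounters A w p"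
    have h: "h \<in> set p \<rightarrow>\<^sub>E {u. u \<noteq> [] \<and> set u \<subseteq> A}" and il: "i + l \<le> ?n"
      and c: "compatible (factor w i l) (map Some (apply_morphism h p))"
      using * by (auto simp: encounters_def nonerasing_morphisms_def)
    have len: "length (apply_morphism h p) \<le> ?n"
      using c il by (auto simp: compatible_def factor_def dest!: list_all2_lengthD)
    have "length (h v) \<le> ?n" if "v \<in> set p" for v
    proof -
      have "length (h v) \<le> length (apply_morphism h p)"
        using that by (auto simp: apply_morphism_def length_concat intro!: member_le_sum_list)
      with len show ?thesis by simp
    qed
    with h il show "h \<in> (set p \<rightarrow>\<^sub>E ?U) \<and> (i, l) \<in> {..?n} \<times> {..?n}"
      by (auto simp: PiE_def Pi_def)
  qed
  moreover have "finite ((set p \<rightarrow>\<^sub>E ?U) \<times> {..?n} \<times> {..?n})"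
    using finite_lists_length_le[OF assms] by (intro finite_cartesian_product finite_PiE) auto
  ultimately show ?thesis
    by (rule finite_subset)
qed

lemma num_occurrences_full_word:
  "num_occurrences A (map Some u) p = card (encounters A (map Some u) p)"
proof -
  let ?f = "\<lambda>(h, i, l). (i, \<lambda>v\<in>set p. length (h v))"
  have enc: "h \<in> extensional (set p) \<and> i + l \<le> length u \<and> take l (drop i u) = apply_morphism h p"
    if "(h, i, l) \<in> encounters A (map Some u) p" for h i l
    using that
    by (auto simp: encounters_def nonerasing_morphisms_def factor_def PiE_def
        compatible_map_Some take_map drop_map)
  have "inj_on ?f (encounters A (map Some u) p)"
  proof (rule inj_onI)
    fix x y
    assume xy: "x \<in> encounters A (map Some u) p" "y \<in> encounters A (map Some u) p" "?f x = ?f y"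
    obtain h i l h' i' l' where x: "x = (h, i, l)" and y: "y = (h', i', l')"
      by (metis prod_cases3)
    have e: "(h, i, l) \<in> encounters A (map Some u) p" "(h', i', l') \<in> encounters A (map Some u) p"
      and eq: "(\<lambda>v\<in>set p. length (h v)) = (\<lambda>v\<in>set p. length (h' v))"
      and ii: "i = i'"
      using xy by (auto simp: x y)
    have len: "length (h v) = length (h' v)" if "v \<in> set p" for v
      using fun_cong[OF eq, of v] that by simp
    have len': "length (apply_morphism h p) = length (apply_morphism h' p)"
      unfolding apply_morphism_def length_concat map_map
      by (rule arg_cong[of _ _ sum_list]) (use len in auto)
    have "l = length (apply_morphism h p)" "l' = length (apply_morphism h' p)"
      using enc[OF e(1)] enc[OF e(2)] by (metis add_le_imp_le_diff add.commute length_drop length_take min.absorb2)+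
    with len' have l: "l = l'" by simp
    have "apply_morphism h p = apply_morphism h' p"
      using enc[OF e(1)] enc[OF e(2)] ii l by simp
    from apply_morphism_inj[OF this len] have "\<forall>v\<in>set p. h v = h' v" .
    then have "h = h'"
      using enc[OF e(1)] enc[OF e(2)] by (auto intro: extensionalityI)
    with ii l show "x = y" by (simp add: x y)
  qed
  then show ?thesis
    by (simp add: num_occurrences_def occurrences_def card_image)
qed

end

theory Submission
  imports Defs "HOL-Analysis.Uniform_Limit" "HOL-Real_Asymp.Real_Asymp"
begin

text \<open>
  Fix a position \<open>i\<close> and block lengths \<open>f v \<ge> 1\<close>. They give an occurrence in a random partial word
  iff, for every variable \<open>v\<close> and every \<open>t < f v\<close>, the \<open>k\<close> positions holding the \<open>t\<close>-th character of
  a copy of \<open>v\<close> (where \<open>v\<close> occurs \<open>k\<close> times) carry at most one letter besides holes. These position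
  classes are disjoint, so the events are independent, each of probability
  \<open>q = (m * 2 ^ k - m + 1) / (m + 1) ^ k\<close>, and the mean is the sum of \<open>\<Prod>v. q v ^ f v\<close> over
  all \<open>(i, f)\<close> that fit into length \<open>n\<close>. For \<open>k = 1\<close> we have \<open>q = 1\<close>, and these variables together
  with \<open>i\<close> contribute a binomial coefficient of order \<open>n ^ (s + 1) / (s + 1)!\<close>. For \<open>k \<ge> 2\<close> and
  \<open>m \<ge> 2\<close> we have \<open>q < 1\<close>, and by dominated convergence each such variable contributes the
  geometric series \<open>q / (1 - q)\<close>.
\<close>

section \<open>Partial words consistent with a labelling of the positions\<close>

text \<open>
  The list \<open>ls\<close> labels each position with its class (\<open>None\<close> for an unconstrained position). The map
  \<open>\<sigma>\<close> records the letters already forced on classes by a prefix read earlier; it only serves to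
  make the count amenable to induction on \<open>ls\<close>.
\<close>

definition class_consistent ::
    "'a set \<Rightarrow> 'c option list \<Rightarrow> ('c \<rightharpoonup> 'a) \<Rightarrow> 'a option list set" where
  "class_consistent A ls \<sigma> = {w \<in> partial_words A (length ls). \<exists>g. range g \<subseteq> A \<and>
     (\<forall>c a. \<sigma> c = Some a \<longrightarrow> g c = a) \<and>
     list_all2 (\<lambda>l x. \<forall>c. l = Some c \<longrightarrow> x \<noteq> None \<longrightarrow> x = Some (g c)) ls w}"

lemma finite_partial_words: "finite A \<Longrightarrow> finite (partial_words A n)"
  unfolding partial_words_def using finite_lists_length_eq[of "insert None (Some ` A)" n] by simp

lemma finite_class_consistent: "finite A \<Longrightarrow> finite (class_consistent A ls \<sigma>)"
  by (rule finite_subset[OF _ finite_partial_words]) (auto simp: class_consistent_def)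

lemma class_consistent_Nil:
  assumes "A \<noteq> {}" and "ran \<sigma> \<subseteq> A"
  shows "class_consistent A [] \<sigma> = {[]}"
proof -
  obtain a where "a \<in> A" using assms by auto
  moreover have "b \<in> A" if "\<sigma> c = Some b" for b c
    using assms(2) that unfolding ran_def by blast
  \<comment> \<open>A total \<open>g\<close> extends the partial assignment \<open>\<sigma>\<close>,
    taking the default letter \<open>a\<close> on classes that \<open>\<sigma>\<close> leaves
    open.\<close>
  ultimately have "\<exists>g. range g \<subseteq> A \<and> (\<forall>c b. \<sigma> c = Some b \<longrightarrow> g c = b)"
    by (intro exI[of _ "\<lambda>c. case \<sigma> c of None \<Rightarrow> a | Some b \<Rightarrow> b"])
      (auto split: option.splits)
  then show ?thesis by (auto simp: class_consistent_def partial_words_def)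
qed

lemma class_consistent_None:
  "class_consistent A (None # ls) \<sigma> =
     (\<lambda>(x, w). x # w) ` (insert None (Some ` A) \<times> class_consistent A ls \<sigma>)"
proof -
  have "w \<in> class_consistent A (None # ls) \<sigma> \<longleftrightarrow>
      w \<in> (\<lambda>(x, w). x # w) ` (insert None (Some ` A) \<times> class_consistent A ls \<sigma>)" for w
    by (cases w) (auto simp: class_consistent_def partial_words_def image_iff)
  then show ?thesis by blast
qed

lemma class_consistent_Some_assigned:
  assumes "\<sigma> c = Some a" and "ran \<sigma> \<subseteq> A"
  shows "class_consistent A (Some c # ls) \<sigma> =
     (\<lambda>(x, w). x # w) ` ({None, Some a} \<times> class_consistent A ls \<sigma>)"
proof -
  have "a \<in> A" using assms by (auto simp: ran_def)
  have "w \<in> class_consistent A (Some c # ls) \<sigma> \<longleftrightarrow>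
      w \<in> (\<lambda>(x, w). x # w) ` ({None, Some a} \<times> class_consistent A ls \<sigma>)" for w
    using assms(1) \<open>a \<in> A\<close>
    by (cases w) (auto simp: class_consistent_def partial_words_def image_iff, blast)
  then show ?thesis by blast
qed

text \<open>A hole read in an open class leaves the class open, whereas a letter \<open>a\<close>
  commits all its later positions to \<open>a\<close> or a hole. The cases differ in the first
  character, so the union is disjoint and cardinalities add.\<close>

lemma class_consistent_Some_free:
  assumes "\<sigma> c = None"
  shows "class_consistent A (Some c # ls) \<sigma> =
     (#) None ` class_consistent A ls \<sigma> \<union>
     (\<lambda>(a, w). Some a # w) ` (SIGMA a:A. class_consistent A ls (\<sigma>(c \<mapsto> a)))"
proof -
  have ext: "(\<forall>d b. (\<sigma>(c \<mapsto> a)) d = Some b \<longrightarrow> g d = b) \<longleftrightarrow>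
      (\<forall>d b. \<sigma> d = Some b \<longrightarrow> g d = b) \<and> g c = a" for g :: "'b \<Rightarrow> 'a" and a
    using assms by auto
  have "w \<in> class_consistent A (Some c # ls) \<sigma> \<longleftrightarrow>
      w \<in> (#) None ` class_consistent A ls \<sigma> \<union>
      (\<lambda>(a, w). Some a # w) ` (SIGMA a:A. class_consistent A ls (\<sigma>(c \<mapsto> a)))" for w
  proof (cases w)
    case Nil
    then show ?thesis by (auto simp: class_consistent_def partial_words_def)
  next
    case (Cons x w')
    show ?thesis
    proof (cases x)
      case None
      then show ?thesis
        by (auto simp: Cons class_consistent_def partial_words_def image_iff)
    next
      case (Some a)
      have "Some a # w' \<in> class_consistent A (Some c # ls) \<sigma> \<longleftrightarrow>
          a \<in> A \<and> w' \<in> class_consistent A ls (\<sigma>(c \<mapsto> a))"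
        unfolding class_consistent_def mem_Collect_eq ext by (auto simp: partial_words_def)
      then show ?thesis by (auto simp: Cons Some)
    qed
  qed
  then show ?thesis by blast
qed

text \<open>A committed class with \<open>j\<close> positions ahead has \<open>2 ^ j\<close>
  fillings, each position being a hole or the forced letter. An open class has the all-hole filling
  and, for each letter, \<open>2 ^ j - 1\<close> fillings using that letter at least once. Distinct
  classes are filled independently. Elements of \<open>C\<close> that label no position contribute
  the factor 1, so \<open>C\<close> may be any finite superset of the labels.\<close>

lemma card_class_consistent:
  assumes "finite A" and "A \<noteq> {}" and "finite C"
    and "\<And>c. Some c \<in> set ls \<Longrightarrow> c \<in> C" and "ran \<sigma> \<subseteq> A"
  shows "card (class_consistent A ls \<sigma>) =
    (card A + 1) ^ count_list ls None *
    (\<Prod>c\<in>C. if \<sigma> c = None then card A * (2 ^ count_list ls (Some c) - 1) + 1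
      else 2 ^ count_list ls (Some c))"
  using assms(4,5)
proof (induction ls arbitrary: \<sigma>)
  case Nil
  then show ?case using assms(2) by (simp add: class_consistent_Nil cong: if_cong)
next
  case (Cons l ls)
  let ?m = "card A"
  let ?F = "\<lambda>ls \<sigma> c. if \<sigma> c = None then ?m * (2 ^ count_list ls (Some c) - 1) + 1
      else 2 ^ count_list ls (Some c) :: nat"
  have IH: "card (class_consistent A ls \<sigma>') = (?m + 1) ^ count_list ls None * (\<Prod>c\<in>C. ?F ls \<sigma>' c)"
    if "ran \<sigma>' \<subseteq> A" for \<sigma>' using Cons.IH[OF _ that] Cons.prems by auto
  have inj: "inj_on (\<lambda>(x, w). x # w) X" for X :: "('a option \<times> 'a option list) set"
    by (auto simp: inj_on_def)
  show ?case
  proof (cases l)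
    case None
    have "card (insert None (Some ` A)) = ?m + 1"
      using assms(1) by (subst card_insert_disjoint) (auto simp: card_image)
    then have "card (class_consistent A (l # ls) \<sigma>) = (?m + 1) * card (class_consistent A ls \<sigma>)"
      unfolding None class_consistent_None
      by (subst card_image[OF inj]) (simp add: card_cartesian_product)
    then show ?thesis using IH[OF Cons.prems(2)] by (simp add: None add_mult_distrib cong: if_cong)
  next
    case (Some c)
    then have cC: "c \<in> C" using Cons.prems by auto
    \<comment> \<open>Reading a position of class \<open>c\<close> changes only the factor of
      \<open>c\<close>; \<open>?P\<close> collects the others.\<close>
    let ?P = "\<lambda>\<sigma>'. \<Prod>d\<in>C - {c}. ?F ls \<sigma>' d"
    have split: "(\<Prod>d\<in>C. ?F ls' \<sigma>' d) = ?F ls' \<sigma>' c * (\<Prod>d\<in>C - {c}. ?F ls' \<sigma>' d)" for ls' \<sigma>'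
      using prod.remove[OF assms(3) cC] .
    have rest: "(\<Prod>d\<in>C - {c}. ?F (l # ls) \<sigma> d) = ?P \<sigma>"
      by (rule prod.cong) (auto simp: Some)
    show ?thesis
    proof (cases "\<sigma> c")
      case None
      let ?j = "count_list ls (Some c)"
      have sub: "ran (\<sigma>(c \<mapsto> a)) \<subseteq> A" if "a \<in> A" for a
        using Cons.prems(2) that None by (auto simp: ran_def)
      have P: "?P (\<sigma>(c \<mapsto> a)) = ?P \<sigma>" for a
        by (rule prod.cong) auto
      have fin: "finite (class_consistent A ls \<sigma>')" for \<sigma>'
        by (rule finite_class_consistent[OF assms(1)])
      have "card (class_consistent A (l # ls) \<sigma>) =
        card (class_consistent A ls \<sigma>) + (\<Sum>a\<in>A. card (class_consistent A ls (\<sigma>(c \<mapsto> a))))"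
        unfolding Some class_consistent_Some_free[where \<sigma> = \<sigma> and c = c, OF None]
        by (subst card_Un_disjoint)
          (use fin assms(1) in \<open>auto simp: card_image inj_on_def card_SigmaI\<close>)
      also have "(\<Sum>a\<in>A. card (class_consistent A ls (\<sigma>(c \<mapsto> a)))) =
        (\<Sum>a\<in>A. (?m + 1) ^ count_list ls None * (2 ^ ?j * ?P \<sigma>))"
        by (rule sum.cong) (simp_all add: IH[OF sub] split P del: fun_upd_apply, simp)
      also have "card (class_consistent A ls \<sigma>) =
        (?m + 1) ^ count_list ls None * ((?m * (2 ^ ?j - 1) + 1) * ?P \<sigma>)"
        using IH[OF Cons.prems(2)] split[of \<sigma> ls] None by simp
      finally have card: "card (class_consistent A (l # ls) \<sigma>) =
        (?m + 1) ^ count_list ls None * ((?m * (2 ^ ?j - 1) + 1 + ?m * 2 ^ ?j) * ?P \<sigma>)"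
        by (simp add: distrib_left distrib_right mult_ac)
      \<comment> \<open>A hole keeps the class open, while each of the \<open>?m\<close> letters
        leaves a committed class with \<open>?j\<close> positions; together they give the open-class
        count for \<open>Suc ?j\<close>.\<close>
      have "?m * (2 ^ ?j - 1) + 1 + ?m * 2 ^ ?j = ?m * ((2 ^ ?j - 1) + 2 ^ ?j) + 1"
        by (simp add: algebra_simps)
      also have "(2 ^ ?j - 1) + 2 ^ ?j = (2 ^ Suc ?j - 1 :: nat)"
        by simp
      finally show ?thesis
        unfolding card split[of \<sigma> "l # ls"] rest by (simp add: Some None)
    next
      case (Some a)
      have "card (class_consistent A (l # ls) \<sigma>) = 2 * card (class_consistent A ls \<sigma>)"
        unfolding \<open>l = Some c\<close> class_consistent_Some_assigned[OF Some Cons.prems(2)]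
        by (subst card_image[OF inj]) (simp add: card_cartesian_product)
      then show ?thesis
        unfolding split[of \<sigma> "l # ls"] rest
        using IH[OF Cons.prems(2)] split[of \<sigma> ls] by (simp add: \<open>l = Some c\<close> Some)
    qed
  qed
qed

section \<open>Weighted placements and their asymptotics\<close>

text \<open>For a pattern, \<open>c v\<close> is the multiplicity of \<open>v\<close> and
  \<open>f v\<close> the length of its image, so the sum is the length of the factor. Keeping
  \<open>c\<close> and the later weights \<open>q\<close> abstract frees the asymptotic analysis
  from words.\<close>

definition placements :: "('v \<Rightarrow> nat) \<Rightarrow> 'v set \<Rightarrow> nat \<Rightarrow> (nat \<times> ('v \<Rightarrow> nat)) set" where
  "placements c V n = {(i, f). f \<in> V \<rightarrow>\<^sub>E {1..} \<and> i + (\<Sum>v\<in>V. c v * f v) \<le> n}"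

definition placement_weight ::
    "('v \<Rightarrow> nat) \<Rightarrow> ('v \<Rightarrow> real) \<Rightarrow> 'v set \<Rightarrow> nat \<Rightarrow> real" where
  "placement_weight c q V n = (\<Sum>(i, f)\<in>placements c V n. \<Prod>v\<in>V. q v ^ f v)"

lemma finite_placements:
  assumes "finite V" and "\<And>v. v \<in> V \<Longrightarrow> c v > 0"
  shows "finite (placements c V n)"
proof (rule finite_subset)
  show "placements c V n \<subseteq> {..n} \<times> (V \<rightarrow>\<^sub>E {..n})"
  proof clarify
    fix i f assume "(i, f) \<in> placements c V n"
    then have f: "f \<in> V \<rightarrow>\<^sub>E {1..}" and le: "i + (\<Sum>v\<in>V. c v * f v) \<le> n"
      by (auto simp: placements_def)
    have "f v \<le> n" if "v \<in> V" for v
    proof -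
      have "f v \<le> c v * f v" using assms(2)[OF that] by simp
      also have "\<dots> \<le> (\<Sum>v\<in>V. c v * f v)"
        using assms(1) that by (intro member_le_sum) auto
      finally show ?thesis using le by simp
    qed
    then show "i \<in> {..n} \<and> f \<in> V \<rightarrow>\<^sub>E {..n}"
      using f le by (auto simp: PiE_def)
  qed
  show "finite ({..n} \<times> (V \<rightarrow>\<^sub>E {..n}))"
    using assms(1) by (auto intro: finite_PiE)
qed

lemma placement_weight_empty: "placement_weight c q {} n = real n + 1"
proof -
  have "placements c {} n = {..n} \<times> {\<lambda>_. undefined}"
    by (auto simp: placements_def)
  then show ?thesis
    by (simp add: placement_weight_def)
qed

text \<open>Fixing the length \<open>t\<close> of the image of \<open>x\<close> uses up
  \<open>c x * t\<close> positions and leaves a placement of the other variables in the remaining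
  length. This convolution drives both the exact count and the asymptotics.\<close>

lemma placement_weight_insert:
  assumes "finite V" and "x \<notin> V" and "c x > 0" and "\<And>v. v \<in> V \<Longrightarrow> c v > 0"
  shows "placement_weight c q (insert x V) n =
    (\<Sum>t | 1 \<le> t \<and> c x * t \<le> n. q x ^ t * placement_weight c q V (n - c x * t))"
proof -
  let ?T = "{t. 1 \<le> t \<and> c x * t \<le> n}"
  have finT: "finite ?T"
  proof (rule finite_subset)
    have "t \<le> c x * t" for t using assms(3) by simp
    then show "?T \<subseteq> {..n}" using order_trans by blast
  qed simp
  have sum_upd: "(\<Sum>v\<in>V. c v * (f(x := t)) v) = (\<Sum>v\<in>V. c v * f v)" for f t
    using assms(2) by (intro sum.cong) auto
  have prod_upd: "(\<Prod>v\<in>V. q v ^ (f(x := t)) v) = (\<Prod>v\<in>V. q v ^ f v)" for f t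
    using assms(2) by (intro prod.cong) auto
  have "placement_weight c q (insert x V) n =
    (\<Sum>(t, i, f)\<in>(SIGMA t:?T. placements c V (n - c x * t)). q x ^ t * (\<Prod>v\<in>V. q v ^ f v))"
    unfolding placement_weight_def
  \<comment> \<open>Resetting the value at \<open>x\<close> to \<open>undefined\<close> makes the
    remaining function extensional on \<open>V\<close>.\<close>
  proof (rule sum.reindex_bij_witness[where
        j = "\<lambda>(i, f). (f x, i, f(x := undefined))" and i = "\<lambda>(t, i, f). (i, f(x := t))"], goal_cases)
    case (1 a)
    then show ?case by (cases a) simp
  next
    case (2 a)
    obtain i f where a: "a = (i, f)" by fastforce
    have f: "f \<in> insert x V \<rightarrow>\<^sub>E {1..}" and le: "i + (c x * f x + (\<Sum>v\<in>V. c v * f v)) \<le> n"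
      using 2 assms(1,2) by (auto simp: placements_def a)
    have "f(x := undefined) \<in> V \<rightarrow>\<^sub>E {1..}" by (rule fun_upd_in_PiE[OF assms(2) f])
    moreover have "f x \<ge> 1" using f by auto
    ultimately show ?case using le by (simp add: a placements_def sum_upd del: fun_upd_apply)
  next
    case (3 b)
    obtain t i f where b: "b = (t, i, f)" by (metis prod_cases3)
    have "f x = undefined" using 3 assms(2) by (auto simp: b placements_def)
    then show ?case by (auto simp: b)
  next
    case (4 b)
    obtain t i f where b: "b = (t, i, f)" by (metis prod_cases3)
    have f: "f \<in> V \<rightarrow>\<^sub>E {1..}" and t: "1 \<le> t" "c x * t \<le> n"
      and le: "i + (\<Sum>v\<in>V. c v * f v) \<le> n - c x * t"
      using 4 by (auto simp: b placements_def)
    have "f(x := t) \<in> insert x V \<rightarrow>\<^sub>E {1..}" using f t by (intro PiE_fun_upd) auto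
    moreover have "i + (\<Sum>v\<in>insert x V. c v * (f(x := t)) v) \<le> n"
      using assms(1,2) sum_upd[of f t] le t by simp
    ultimately show ?case by (simp add: b placements_def del: fun_upd_apply)
  next
    case (5 a)
    obtain i f where a: "a = (i, f)" by fastforce
    show ?case using assms(1,2) prod_upd[of f undefined] by (simp add: a)
  qed
  also have "\<dots> = (\<Sum>t\<in>?T. \<Sum>(i, f)\<in>placements c V (n - c x * t). q x ^ t * (\<Prod>v\<in>V. q v ^ f v))"
    using finT finite_placements[OF assms(1,4)] by (subst sum.Sigma) (auto simp: case_prod_unfold)
  finally show ?thesis
    by (simp add: placement_weight_def sum_distrib_left case_prod_unfold)
qed

lemma placement_weight_linear:
  assumes "finite V" and "\<And>v. v \<in> V \<Longrightarrow> c v = 1" and "\<And>v. v \<in> V \<Longrightarrow> q v = 1"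
  shows "placement_weight c q V n = real (Suc n choose Suc (card V))"
  using assms
proof (induction V arbitrary: n rule: finite_induct)
  case empty
  then show ?case by (simp add: placement_weight_empty)
next
  case (insert x V)
  have "placement_weight c q (insert x V) n =
    (\<Sum>t | 1 \<le> t \<and> t \<le> n. real (Suc (n - t) choose Suc (card V)))"
    using insert by (subst placement_weight_insert) auto
  also have "\<dots> = (\<Sum>k\<in>{1..n}. real (k choose Suc (card V)))"
    by (rule sum.reindex_bij_witness[where i = "\<lambda>k. Suc n - k" and j = "\<lambda>t. Suc n - t"])
      (auto simp: Suc_diff_le)
  also have "\<dots> = (\<Sum>k\<le>n. real (k choose Suc (card V)))"
    by (rule sum.mono_neutral_left) (auto simp: not_le)
  also have "\<dots> = real (Suc n choose Suc (Suc (card V)))"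
    unfolding sum_choose_upper[symmetric] by simp
  finally show ?case using insert by simp
qed

section \<open>Limits of normalised placement weights\<close>

lemma binomial_over_power_tendsto:
  "(\<lambda>n. real (Suc n choose d) / (real n + 1) ^ d) \<longlonglongrightarrow> 1 / fact d"
proof (induction d)
  case (Suc d)
  have step: "real (Suc n choose Suc d) / (real n + 1) ^ Suc d =
      real (Suc n choose d) / (real n + 1) ^ d * ((real n + 1 - real d) / (real n + 1) / real (Suc d))"
    for n
  proof -
    have "real (Suc d) * real (Suc n choose Suc d) = (real n + 1 - real d) * real (Suc n choose d)"
    \<comment> \<open>For \<open>d > Suc n\<close> both binomials vanish; otherwise the natural
      subtraction is exact.\<close>
    proof (cases "d \<le> Suc n")
      case True
      have "Suc d * (Suc n choose Suc d) = (Suc n - d) * (Suc n choose d)"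
        by (metis Suc_times_binomial_eq binomial_absorb_comp diff_Suc_1 mult.commute)
      then have "real (Suc d) * real (Suc n choose Suc d) = real (Suc n - d) * real (Suc n choose d)"
        by (metis of_nat_mult)
      then show ?thesis using True by (simp add: of_nat_diff)
    qed (simp add: not_le binomial_eq_0)
    then show ?thesis by (simp add: divide_simps) (simp add: algebra_simps)
  qed
  have "(\<lambda>n. (real n + 1 - real d) / (real n + 1)) \<longlonglongrightarrow> 1"
    by real_asymp
  then have quotient: "(\<lambda>n. (real n + 1 - real d) / (real n + 1) / real (Suc d)) \<longlonglongrightarrow> 1 / real (Suc d)"
    by (rule tendsto_divide) auto
  have fact: "1 / fact d * (1 / real (Suc d)) = (1 / fact (Suc d) :: real)" by simp
  from tendsto_mult[OF Suc quotient] show ?case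
    by (simp only: step fact)
qed simp

text \<open>For fixed \<open>t\<close> the shift by \<open>k * t\<close> does not affect the limit,
  so the term tends to \<open>q ^ t * L\<close>. Tannery's theorem with the majorant
  \<open>B * q ^ t\<close> permits summing these limits. Normalising by \<open>real n + 1\<close>
  keeps every denominator nonzero, so one bound \<open>B\<close> serves all
  \<open>n\<close>.\<close>

lemma geometric_convolution_tendsto:
  fixes S :: "nat \<Rightarrow> real" and q L :: real
  assumes S: "(\<lambda>n. S n / (real n + 1) ^ d) \<longlonglongrightarrow> L"
    and q: "0 \<le> q" "q < 1" and k: "k > 0"
  shows "(\<lambda>n. (\<Sum>t | 1 \<le> t \<and> k * t \<le> n. q ^ t * S (n - k * t)) / (real n + 1) ^ d)
    \<longlonglongrightarrow> q / (1 - q) * L"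
proof -
  \<comment> \<open>Extension by zero turns the sum, whose range depends on \<open>n\<close>, into a
    series over all \<open>t\<close>.\<close>
  define a where "a t n = (if 1 \<le> t \<and> k * t \<le> n
    then q ^ t * (S (n - k * t) / (real n + 1) ^ d) else 0)" for t n
  obtain B where B: "\<bar>S n / (real n + 1) ^ d\<bar> \<le> B" for n
    using convergent_imp_Bseq[OF convergentI[OF S]] by (auto simp: Bseq_def simp del: abs_divide)
  have bound: "norm (a t n) \<le> B * q ^ t" for t n
  proof (cases "1 \<le> t \<and> k * t \<le> n")
    case True
    have "\<bar>S (n - k * t) / (real n + 1) ^ d\<bar> \<le> \<bar>S (n - k * t) / (real (n - k * t) + 1) ^ d\<bar>"
      unfolding abs_divide
      by (rule divide_left_mono) (auto simp: power_abs intro!: power_mono)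
    also have "\<dots> \<le> B" by (rule B)
    finally have "q ^ t * \<bar>S (n - k * t) / (real n + 1) ^ d\<bar> \<le> q ^ t * B"
      using q by (intro mult_left_mono) auto
    then show ?thesis
      using True q by (simp add: a_def abs_mult power_abs mult.commute)
  next
    case False
    have "B \<ge> 0" using B[of 0] by linarith
    then show ?thesis using False q by (auto simp: a_def)
  qed
  have lim: "(\<lambda>n. a t n) \<longlonglongrightarrow> (if t = 0 then 0 else q ^ t * L)" for t
  proof (cases "t = 0")
    case False
    have "filterlim (\<lambda>n. n - k * t) at_top at_top"
      by (rule filterlim_minus_const_nat_at_top)
    from filterlim_compose[OF S this]
    have 1: "(\<lambda>n. S (n - k * t) / (real (n - k * t) + 1) ^ d) \<longlonglongrightarrow> L" .
    have "(\<lambda>n. (real n - real (k * t) + 1) / (real n + 1)) \<longlonglongrightarrow> 1"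
      by real_asymp
    \<comment> \<open>The term factors into \<open>S\<close> normalised at its own argument and a
      power of the ratio of the two normalisations, which tends to 1.\<close>
    from tendsto_mult[OF tendsto_const[of "q ^ t"] tendsto_mult[OF 1 tendsto_power[OF this, of d]]]
    have "(\<lambda>n. q ^ t * (S (n - k * t) / (real (n - k * t) + 1) ^ d *
      ((real n - real (k * t) + 1) / (real n + 1)) ^ d)) \<longlonglongrightarrow> q ^ t * L"
      by simp
    moreover have "\<forall>\<^sub>F n in sequentially. q ^ t * (S (n - k * t) / (real (n - k * t) + 1) ^ d *
      ((real n - real (k * t) + 1) / (real n + 1)) ^ d) = a t n"
      using eventually_ge_at_top[of "k * t"]
    proof eventually_elim
      case (elim n)
      then have "real n - real (k * t) + 1 = real (n - k * t) + 1" by (simp add: of_nat_diff)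
      moreover have "(real (n - k * t) + 1) ^ d \<noteq> 0" by (simp add: add_eq_0_iff)
      ultimately show ?case using False elim by (simp add: a_def power_divide)
    qed
    ultimately show ?thesis using False by (auto intro: Lim_transform_eventually)
  qed (simp add: a_def)
  have "summable (\<lambda>t. B * q ^ t)" using q by (intro summable_mult summable_geometric) simp
  moreover have "\<forall>\<^sub>F (t, n) in sequentially \<times>\<^sub>F sequentially. norm (a t n) \<le> B * q ^ t"
    using bound by (intro always_eventually) auto
  ultimately have "(\<lambda>n. \<Sum>t. a t n) \<longlonglongrightarrow> (\<Sum>t. if t = 0 then 0 else q ^ t * L)"
    using tannerys_theorem[where a = a, OF lim] by simp
  also have "(\<lambda>n. \<Sum>t. a t n) =
    (\<lambda>n. (\<Sum>t | 1 \<le> t \<and> k * t \<le> n. q ^ t * S (n - k * t)) / (real n + 1) ^ d)"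
  proof
    fix n
    have "finite {t. 1 \<le> t \<and> k * t \<le> n}"
    proof (rule finite_subset)
      have "t \<le> k * t" for t using k by simp
      then show "{t. 1 \<le> t \<and> k * t \<le> n} \<subseteq> {..n}" using order_trans by blast
    qed simp
    then have "(\<Sum>t. a t n) = (\<Sum>t | 1 \<le> t \<and> k * t \<le> n. a t n)"
      by (rule suminf_finite) (auto simp: a_def)
    also have "\<dots> = (\<Sum>t | 1 \<le> t \<and> k * t \<le> n. q ^ t * S (n - k * t)) / (real n + 1) ^ d"
      unfolding sum_divide_distrib by (rule sum.cong) (auto simp: a_def)
    finally show "(\<Sum>t. a t n) = \<dots>" .
  qed
  also have "(\<Sum>t. if t = 0 then 0 else q ^ t * L) = q / (1 - q) * L"
  proof -
    \<comment> \<open>The series starts at \<open>t = 1\<close>; the factor \<open>q\<close> split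
      off here shifts it to an ordinary geometric series.\<close>
    have "(\<lambda>t. q ^ t * (q * L)) sums (1 / (1 - q) * (q * L))"
      using q by (intro sums_mult2 geometric_sums) simp
    then have "(\<lambda>t. (if Suc t = 0 then 0 else q ^ Suc t * L)) sums (q / (1 - q) * L)"
      by (simp add: mult_ac)
    from sums_Suc[OF this] show ?thesis using sums_unique by fastforce
  qed
  finally show ?thesis .
qed

text \<open>\<open>U\<close> alone fixes the order of growth through the binomial coefficient. Each
  element of \<open>V\<close> enters by a geometric convolution, which multiplies the limit by
  \<open>q v / (1 - q v)\<close> and keeps the exponent.\<close>

lemma placement_weight_tendsto:
  assumes "finite U" "finite V" "U \<inter> V = {}"
    and "\<And>v. v \<in> U \<Longrightarrow> c v = 1" "\<And>v. v \<in> U \<Longrightarrow> q v = 1"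
    and "\<And>v. v \<in> V \<Longrightarrow> c v > 0" "\<And>v. v \<in> V \<Longrightarrow> 0 \<le> q v" "\<And>v. v \<in> V \<Longrightarrow> q v < 1"
  shows "(\<lambda>n. placement_weight c q (U \<union> V) n / (real n + 1) ^ Suc (card U))
    \<longlonglongrightarrow> (\<Prod>v\<in>V. q v / (1 - q v)) / fact (Suc (card U))"
  using assms(2,1,3-)
proof (induction V rule: finite_induct)
  case empty
  show ?case using binomial_over_power_tendsto[of "Suc (card U)"] empty
    by (simp add: placement_weight_linear del: power_Suc)
next
  case (insert x V)
  have "(\<lambda>n. placement_weight c q (U \<union> V) n / (real n + 1) ^ Suc (card U))
    \<longlonglongrightarrow> (\<Prod>v\<in>V. q v / (1 - q v)) / fact (Suc (card U))"
    using insert by auto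
  from geometric_convolution_tendsto[OF this, of "q x" "c x"] insert.prems
  have *: "(\<lambda>n. (\<Sum>t | 1 \<le> t \<and> c x * t \<le> n. q x ^ t * placement_weight c q (U \<union> V) (n - c x * t)) /
      (real n + 1) ^ Suc (card U))
    \<longlonglongrightarrow> q x / (1 - q x) * ((\<Prod>v\<in>V. q v / (1 - q v)) / fact (Suc (card U)))"
    by simp
  have eq: "placement_weight c q (U \<union> insert x V) n =
    (\<Sum>t | 1 \<le> t \<and> c x * t \<le> n. q x ^ t * placement_weight c q (U \<union> V) (n - c x * t))" for n
  proof -
    have pos: "c v > 0" if "v \<in> U \<union> V" for v
      using that insert.prems(3)[of v] insert.prems(5)[of v] by auto
    have "x \<notin> U \<union> V" using insert by auto
    then show ?thesis
      using placement_weight_insert[of "U \<union> V" x c q n] pos insert by simp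
  qed
  show ?case
    using * insert.hyps unfolding eq by (simp add: mult.assoc del: power_Suc fact_Suc)
qed


section \<open>Occurrences as placements\<close>

text \<open>This is the image of \<open>p\<close> under the morphism sending \<open>v\<close> to the
  formal letters \<open>(v, 0)\<close>, ..., \<open>(v, f v - 1)\<close>. Equal entries mark
  positions that every morphism with block lengths \<open>f\<close> fills with the same
  letter.\<close>

definition position_classes :: "'v list \<Rightarrow> ('v \<Rightarrow> nat) \<Rightarrow> ('v \<times> nat) list" where
  "position_classes p f = concat (map (\<lambda>v. map (Pair v) [0..<f v]) p)"

definition padded_classes ::
    "nat \<Rightarrow> 'v list \<Rightarrow> nat \<Rightarrow> ('v \<Rightarrow> nat) \<Rightarrow> ('v \<times> nat) option list" where
  "padded_classes n p i f = replicate i None @ map Some (position_classes p f) @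
     replicate (n - (i + length (position_classes p f))) None"

lemma length_position_classes:
  "length (position_classes p f) = (\<Sum>v\<in>set p. count_list p v * f v)"
  by (simp add: position_classes_def length_concat comp_def sum_list_map_eq_sum_count)

lemma count_position_classes:
  "count_list (position_classes p f) (v, t) = (if t < f v then count_list p v else 0)"
proof -
  have "count_list (map (Pair u) [0..<j]) (v, t) = (if u = v \<and> t < j then 1 else 0)" for u j
    by (induction j) auto
  then show ?thesis
    by (induction p) (auto simp: position_classes_def)
qed

text \<open>Substituting actual letters for the formal ones yields a genuine morphism; this is the
  bridge between assignments on classes and morphisms.\<close>

lemma map_position_classes:
  "map g (position_classes p f) =
     apply_morphism (\<lambda>v\<in>set p. map (\<lambda>t. g (v, t)) [0..<f v]) p"
  unfolding position_classes_def apply_morphism_def map_concat map_map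
  by (rule arg_cong[of _ _ concat]) (auto simp: comp_def)

lemma length_padded_classes:
  "i + length (position_classes p f) \<le> n \<Longrightarrow> length (padded_classes n p i f) = n"
  by (simp add: padded_classes_def)

lemma list_all2_padded_classes:
  assumes "length w = n" and "i + length (position_classes p f) \<le> n"
  shows "list_all2 (\<lambda>l x. \<forall>c. l = Some c \<longrightarrow> x \<noteq> None \<longrightarrow> x = Some (g c)) (padded_classes n p i f) w \<longleftrightarrow>
    compatible (factor w i (length (position_classes p f))) (map Some (map g (position_classes p f)))"
    (is "list_all2 ?R _ _ \<longleftrightarrow> _")
proof -
  let ?l = "length (position_classes p f)"
  have w: "w = take i w @ factor w i ?l @ drop ?l (drop i w)"
    unfolding factor_def by (simp only: append_take_drop_id)
  have free: "list_all2 ?R (replicate j None) x" if "length x = j" for j x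
    using that by (simp add: list_all2_conv_all_nth)
  have len: "length (factor w i ?l) = ?l"
    using assms by (simp add: factor_def)
  have ends: "list_all2 ?R (replicate i None) (take i w)"
    "list_all2 ?R (replicate (n - (i + ?l)) None) (drop ?l (drop i w))"
    by (rule free; use assms in simp)+
  have "list_all2 ?R (padded_classes n p i f) w \<longleftrightarrow>
      list_all2 ?R (map Some (position_classes p f)) (factor w i ?l)"
    unfolding padded_classes_def
    by (subst w, subst list_all2_append, use assms in simp, subst list_all2_append)
      (use assms len ends in auto)
  also have "\<dots> \<longleftrightarrow> compatible (factor w i ?l) (map Some (map g (position_classes p f)))"
    using len by (auto simp: compatible_def list_all2_conv_all_nth simp del: split_paired_All)
  finally show ?thesis .
qed

text \<open>Once the block lengths are fixed, a morphism amounts to a choice of one letter per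
  class. The existence of a compatible morphism thus becomes the existence of the assignment in
  \<open>class_consistent\<close>.\<close>

lemma occurrences_iff_class_consistent:
  assumes "A \<noteq> {}" and w: "w \<in> partial_words A n"
  shows "(i, f) \<in> occurrences A w p \<longleftrightarrow>
    (i, f) \<in> placements (count_list p) (set p) n \<and>
    w \<in> class_consistent A (padded_classes n p i f) Map.empty"
proof
  have len: "length w = n" using w by (simp add: partial_words_def)
  assume "(i, f) \<in> occurrences A w p"
  then obtain h l where e: "(h, i, l) \<in> encounters A w p" and f: "f = (\<lambda>v\<in>set p. length (h v))"
    by (auto simp: occurrences_def)
  have h: "h \<in> set p \<rightarrow>\<^sub>E {u. u \<noteq> [] \<and> set u \<subseteq> A}" and il: "i + l \<le> n"
    and c: "compatible (factor w i l) (map Some (apply_morphism h p))"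
    using e len by (auto simp: encounters_def nonerasing_morphisms_def)
  obtain a where a: "a \<in> A" using assms(1) by auto
  \<comment> \<open>\<open>g\<close> reads off the letters of \<open>h\<close>; the default
    \<open>a\<close> keeps its whole range inside \<open>A\<close>.\<close>
  define g where "g = (\<lambda>(v, t). if v \<in> set p \<and> t < length (h v) then h v ! t else a)"
  have "(\<lambda>v\<in>set p. map (\<lambda>t. g (v, t)) [0..<f v]) = h"
  proof
    fix v
    show "(\<lambda>v\<in>set p. map (\<lambda>t. g (v, t)) [0..<f v]) v = h v"
      using h by (auto simp: g_def f PiE_def extensional_def intro!: nth_equalityI)
  qed
  then have hg: "apply_morphism h p = map g (position_classes p f)"
    by (simp add: map_position_classes)
  have l: "l = length (position_classes p f)"
    using list_all2_lengthD[OF c[unfolded compatible_def]] il len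
    by (simp add: hg factor_def)
  have "f \<in> set p \<rightarrow>\<^sub>E {1..}"
  proof (rule PiE_I)
    fix v assume v: "v \<in> set p"
    then have "h v \<noteq> []" using h by auto
    then show "f v \<in> {1..}" using v by (cases "h v") (auto simp: f)
  qed (simp add: f)
  then have "(i, f) \<in> placements (count_list p) (set p) n"
    using il by (simp add: placements_def l length_position_classes)
  moreover have "range g \<subseteq> A"
  proof -
    have "h v ! t \<in> A" if "v \<in> set p" "t < length (h v)" for v t
    proof -
      have "set (h v) \<subseteq> A" using h that(1) by auto
      then show ?thesis using nth_mem[OF that(2)] by blast
    qed
    then show ?thesis using a by (auto simp: g_def)
  qed
  ultimately show "(i, f) \<in> placements (count_list p) (set p) n \<and>
    w \<in> class_consistent A (padded_classes n p i f) Map.empty"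
    using w il c list_all2_padded_classes[OF len, of i p f g]
    by (auto simp: class_consistent_def length_padded_classes l hg)
next
  have len: "length w = n" using w by (simp add: partial_words_def)
  assume *: "(i, f) \<in> placements (count_list p) (set p) n \<and>
    w \<in> class_consistent A (padded_classes n p i f) Map.empty"
  then have f: "f \<in> set p \<rightarrow>\<^sub>E {1..}" and il: "i + length (position_classes p f) \<le> n"
    by (auto simp: placements_def length_position_classes)
  obtain g where g: "range g \<subseteq> A"
    and c: "compatible (factor w i (length (position_classes p f)))
      (map Some (map g (position_classes p f)))"
    using * list_all2_padded_classes[OF len il] by (auto simp: class_consistent_def)
  let ?h = "\<lambda>v\<in>set p. map (\<lambda>t. g (v, t)) [0..<f v]"
  have "f v \<ge> 1" if "v \<in> set p" for v using f that by auto
  then have "?h \<in> nonerasing_morphisms (set p) A"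
    using g by (fastforce simp: nonerasing_morphisms_def)
  then have "(?h, i, length (position_classes p f)) \<in> encounters A w p"
    using il c len by (simp add: encounters_def map_position_classes)
  moreover have "(\<lambda>v\<in>set p. length (?h v)) = f"
    using f by (auto simp: PiE_def extensional_def fun_eq_iff)
  ultimately show "(i, f) \<in> occurrences A w p"
    by (force simp: occurrences_def)
qed

section \<open>Exact formula for the mean\<close>

lemma count_list_replicate: "count_list (replicate j x) y = (if x = y then j else 0)"
  by (induction j) auto

lemma count_list_map_Some:
  "count_list (map Some xs) (Some x) = count_list xs x" "count_list (map Some xs) None = 0"
  by (induction xs) auto

text \<open>Each variable \<open>v\<close> has \<open>f v\<close> classes of
  \<open>count_list p v\<close> positions, all with the same number of fillings. The positions
  outside the factor are free and cancel against part of the total.\<close>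

lemma class_consistent_probability:
  assumes "finite A" and "A \<noteq> {}" and "(i, f) \<in> placements (count_list p) (set p) n"
  shows "real (card (class_consistent A (padded_classes n p i f) Map.empty)) / (real (card A) + 1) ^ n =
    (\<Prod>v\<in>set p. ((real (card A) * 2 ^ count_list p v - real (card A) + 1) /
      (real (card A) + 1) ^ count_list p v) ^ f v)"
proof -
  let ?m = "card A" and ?l = "length (position_classes p f)"
  let ?C = "SIGMA v:set p. {..<f v}"
  have il: "i + ?l \<le> n"
    using assms(3) by (simp add: placements_def length_position_classes)
  have None: "count_list (padded_classes n p i f) None = n - ?l"
    using il by (simp add: padded_classes_def count_list_replicate count_list_map_Some)
  have Some: "count_list (padded_classes n p i f) (Some (v, t)) = count_list p v" if "t < f v" for v t
    using that
    by (simp add: padded_classes_def count_list_replicate count_list_map_Some count_position_classes)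
  have mem: "c \<in> ?C" if "Some c \<in> set (padded_classes n p i f)" for c
    using that by (auto simp: padded_classes_def position_classes_def)
  have "card (class_consistent A (padded_classes n p i f) Map.empty) =
    (?m + 1) ^ (n - ?l) * (\<Prod>c\<in>?C. ?m * (2 ^ count_list (padded_classes n p i f) (Some c) - 1) + 1)"
    by (subst card_class_consistent[OF assms(1,2), of ?C])
      (use mem in \<open>auto simp: None\<close>)
  also have "(\<Prod>c\<in>?C. ?m * (2 ^ count_list (padded_classes n p i f) (Some c) - 1) + 1) =
      (\<Prod>(v, t)\<in>?C. ?m * (2 ^ count_list p v - 1) + 1)"
    by (rule prod.cong) (auto simp: Some)
  also have "\<dots> = (\<Prod>v\<in>set p. (?m * (2 ^ count_list p v - 1) + 1) ^ f v)"
    by (subst prod.Sigma[symmetric]) auto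
  finally have card: "real (card (class_consistent A (padded_classes n p i f) Map.empty)) =
    (real ?m + 1) ^ (n - ?l) * (\<Prod>v\<in>set p. (real ?m * 2 ^ count_list p v - real ?m + 1) ^ f v)"
    by (simp add: of_nat_diff algebra_simps)
  have "(real ?m + 1) ^ n = (real ?m + 1) ^ (n - ?l) * (real ?m + 1) ^ ?l"
    using il by (simp flip: power_add)
  also have "(real ?m + 1) ^ ?l = (\<Prod>v\<in>set p. ((real ?m + 1) ^ count_list p v) ^ f v)"
    by (simp add: length_position_classes power_sum power_mult)
  finally have pow: "(real ?m + 1) ^ n =
    (real ?m + 1) ^ (n - ?l) * (\<Prod>v\<in>set p. ((real ?m + 1) ^ count_list p v) ^ f v)" .
  have "(real ?m + 1) ^ (n - ?l) \<noteq> 0"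
    by (simp add: add_eq_0_iff)
  then show ?thesis
    unfolding card pow by (simp add: power_divide prod_dividef)
qed

text \<open>This is linearity of expectation: the sums over words and placements are exchanged, and
  each placement contributes its probability.\<close>

lemma mean_occurrences_eq_placement_weight:
  assumes "finite A" and "A \<noteq> {}"
  shows "mean_occurrences A p n = placement_weight (count_list p)
    (\<lambda>v. (real (card A) * 2 ^ count_list p v - real (card A) + 1) /
      (real (card A) + 1) ^ count_list p v) (set p) n"
proof -
  let ?P = "placements (count_list p) (set p) n"
  let ?K = "\<lambda>(i, f). class_consistent A (padded_classes n p i f) Map.empty"
  have fin: "finite ?P"
    by (rule finite_placements) (simp_all add: count_list_0_iff neq0_conv[symmetric] del: neq0_conv)
  have num: "real (num_occurrences A w p) = (\<Sum>x\<in>?P. of_bool (w \<in> ?K x))"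
    if "w \<in> partial_words A n" for w
  proof -
    have "occurrences A w p = {x \<in> ?P. w \<in> ?K x}"
      using occurrences_iff_class_consistent[OF assms(2) that, of _ _ p] by auto
    then show ?thesis
      using fin by (simp add: num_occurrences_def Int_def)
  qed
  have K: "(\<Sum>w\<in>partial_words A n. of_bool (w \<in> ?K x)) = real (card (?K x))" if "x \<in> ?P" for x
  proof -
    have "?K x \<subseteq> partial_words A n"
      using that by (auto simp: class_consistent_def placements_def length_padded_classes
          length_position_classes)
    then have "{w \<in> partial_words A n. w \<in> ?K x} = ?K x" by blast
    then show ?thesis
      using finite_partial_words[OF assms(1)] by (simp add: Int_def)
  qed
  have "(\<Sum>w\<in>partial_words A n. real (num_occurrences A w p)) =
    (\<Sum>w\<in>partial_words A n. \<Sum>x\<in>?P. of_bool (w \<in> ?K x))"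
    by (rule sum.cong) (simp_all add: num)
  also have "\<dots> = (\<Sum>x\<in>?P. \<Sum>w\<in>partial_words A n. of_bool (w \<in> ?K x))"
    by (rule sum.swap)
  also have "\<dots> = (\<Sum>x\<in>?P. real (card (?K x)))"
    by (rule sum.cong) (simp_all add: K)
  finally have "mean_occurrences A p n = (\<Sum>x\<in>?P. real (card (?K x)) / (real (card A) + 1) ^ n)"
    by (simp add: mean_occurrences_def card_partial_words[OF assms(1)] sum_divide_distrib add.commute)
  also have "\<dots> = placement_weight (count_list p)
    (\<lambda>v. (real (card A) * 2 ^ count_list p v - real (card A) + 1) /
      (real (card A) + 1) ^ count_list p v) (set p) n"
    unfolding placement_weight_def
    by (rule sum.cong) (auto simp: class_consistent_probability[OF assms])
  finally show ?thesis .
qed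

text \<open>This makes the geometric ratios less than 1. With \<open>m = 1\<close> both sides would
  equal \<open>2 ^ k\<close>, since a single letter can never conflict.\<close>

lemma repetition_count_less_power:
  fixes m :: real
  assumes "m \<ge> 2" and "k \<ge> 2"
  shows "m * 2 ^ k - m + 1 < (m + 1) ^ k"
  using assms(2)
proof (induction k rule: nat_induct_at_least)
  case base
  have "m < m * m" using assms(1) by simp
  then show ?case by (simp add: power2_eq_square algebra_simps)
next
  case (Suc k)
  let ?N = "m * 2 ^ k - m + 1"
  have "m * 2 \<le> m * 2 ^ k"
    using assms(1) Suc.hyps power_increasing[of 1 k "2::real"] by (intro mult_left_mono) auto
  then have N: "?N \<ge> m" by simp
  have "m * 2 ^ Suc k - m + 1 = 2 * ?N + m - 1" by simp
  \<comment> \<open>Here \<open>?N \<ge> m\<close> absorbs \<open>m - 1\<close>, and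
    \<open>m \<ge> 2\<close> then gives \<open>3 \<le> m + 1\<close>.\<close>
  also have "\<dots> < 3 * ?N" using N by simp
  also have "\<dots> \<le> (m + 1) * ?N" using N assms(1) by (intro mult_right_mono) auto
  also have "\<dots> \<le> (m + 1) ^ Suc k" using Suc.IH assms(1) by (simp add: mult_left_mono)
  finally show ?case .
qed

text \<open>The condition \<open>m \<ge> 2\<close> for \<open>s < r\<close> keeps the denominators
  nonzero: over one letter all the probabilities are 1.\<close>

theorem theorem8:
  fixes A :: "'a set" and p :: "'v list" and var :: "nat \<Rightarrow> 'v" and k :: "nat \<Rightarrow> nat"
    and m r s :: nat
  assumes "finite A" and "card A = m" and "m \<ge> 1"
    and "bij_betw var {1..r} (set p)"
    and "\<And>j. j \<in> {1..r} \<Longrightarrow> k j = count_list p (var j)"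
    and "s \<le> r"
    and "\<And>j. j \<in> {1..s} \<Longrightarrow> k j = 1"
    and "\<And>j. j \<in> {s+1..r} \<Longrightarrow> 1 < k j"
    and "mono_on {1..r} k"
    and "s < r \<Longrightarrow> m \<ge> 2"
  shows "(\<lambda>n. mean_occurrences A p n) \<sim>[at_top]
    (\<lambda>n. real n ^ (s + 1) / fact (s + 1) *
       (\<Prod>j = s+1..r. (real m * 2 ^ k j - real m + 1) /
          ((real m + 1) ^ k j - (real m * 2 ^ k j - real m + 1))))"
proof -
  \<comment> \<open>\<open>N k\<close> is the number of ways to fill a class of \<open>k\<close>
    positions with holes and at most one letter.\<close>
  define N where "N k = real m * 2 ^ k - real m + 1" for k
  define q where "q v = N (count_list p v) / (real m + 1) ^ count_list p v" for v
  define U where "U = var ` {1..s}"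
  define V where "V = var ` {s+1..r}"
  define P where "P = (\<Prod>j = s+1..r. N (k j) / ((real m + 1) ^ k j - N (k j)))"
  have inj: "inj_on var {1..r}" and img: "var ` {1..r} = set p"
    using assms(4) by (auto simp: bij_betw_def)
  have "A \<noteq> {}" using assms(2,3) by auto
  have split: "{1..r} = {1..s} \<union> {s+1..r}" using assms(6) by auto
  have UV: "U \<union> V = set p" unfolding U_def V_def image_Un[symmetric] split[symmetric] by (rule img)
  have disj: "U \<inter> V = {}"
    unfolding U_def V_def using inj_on_image_Int[OF inj, of "{1..s}" "{s+1..r}"] assms(6) by auto
  have cardU: "card U = s"
    unfolding U_def using inj_on_subset[OF inj, of "{1..s}"] assms(6) by (simp add: card_image)
  have U1: "count_list p v = 1" if "v \<in> U" for v
    using that assms(5,6,7) by (fastforce simp: U_def)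
  have kV: "k j = count_list p (var j)" if "j \<in> {s+1..r}" for j
    using that assms(5)[of j] by auto
  have V2: "count_list p v \<ge> 2 \<and> m \<ge> 2" if "v \<in> V" for v
  proof -
    obtain j where j: "j \<in> {s+1..r}" "v = var j" using \<open>v \<in> V\<close> by (auto simp: V_def)
    show ?thesis using assms(8)[OF j(1)] kV[OF j(1)] assms(10) j by auto
  qed
  have Npos: "N j > 0" for j
  proof -
    have "real m * 1 \<le> real m * 2 ^ j" by (intro mult_left_mono) auto
    then show ?thesis by (simp add: N_def)
  qed
  have Nless: "N (count_list p v) < (real m + 1) ^ count_list p v" if "v \<in> V" for v
    unfolding N_def using V2[OF that] by (intro repetition_count_less_power) auto
  have mean: "mean_occurrences A p n = placement_weight (count_list p) q (U \<union> V) n" for n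
    unfolding mean_occurrences_eq_placement_weight[OF assms(1) \<open>A \<noteq> {}\<close>] UV q_def N_def assms(2) ..
  have "(\<lambda>n. placement_weight (count_list p) q (U \<union> V) n / (real n + 1) ^ Suc (card U))
      \<longlonglongrightarrow> (\<Prod>v\<in>V. q v / (1 - q v)) / fact (Suc (card U))"
  proof (rule placement_weight_tendsto[OF _ _ disj U1])
    show "q v = 1" if "v \<in> U" for v
      using U1[OF that] by (simp add: q_def N_def)
    show "count_list p v > 0" if "v \<in> V" for v
      using V2[OF that] by simp
    show "0 \<le> q v" for v
      using less_imp_le[OF Npos] by (simp add: q_def)
    show "q v < 1" if "v \<in> V" for v
      using Nless[OF that] Npos[of "count_list p v"] by (simp add: q_def)
  qed (simp_all add: U_def V_def)
  also have "(\<Prod>v\<in>V. q v / (1 - q v)) = P"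
  proof -
    have "inj_on var {s+1..r}" by (rule inj_on_subset[OF inj]) auto
    then have "(\<Prod>v\<in>V. q v / (1 - q v)) = (\<Prod>j = s+1..r. q (var j) / (1 - q (var j)))"
      by (simp add: V_def prod.reindex)
    also have "\<dots> = P"
      unfolding P_def
    proof (rule prod.cong)
      fix j assume j: "j \<in> {s+1..r}"
      have "(real m + 1) ^ k j > 0" by simp
      then show "q (var j) / (1 - q (var j)) = N (k j) / ((real m + 1) ^ k j - N (k j))"
        by (simp add: q_def kV[OF j, symmetric] divide_simps)
    qed simp
    finally show ?thesis .
  qed
  finally have lim: "(\<lambda>n. mean_occurrences A p n / (real n + 1) ^ (s + 1)) \<longlonglongrightarrow> P / fact (s + 1)"
    by (simp only: mean cardU Suc_eq_plus1)
  \<comment> \<open>A nonzero limit is what turns convergence of the normalised mean into asymptotic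
    equivalence.\<close>
  have "P > 0"
    unfolding P_def
  proof (rule prod_pos)
    fix j assume j: "j \<in> {s+1..r}"
    then have "var j \<in> V" by (auto simp: V_def)
    from Nless[OF this] Npos show "N (k j) / ((real m + 1) ^ k j - N (k j)) > 0"
      by (simp add: kV[OF j])
  qed
  \<comment> \<open>This ratio converts the normalisation by \<open>real n + 1\<close> into the
    stated power of \<open>real n\<close>.\<close>
  have "(\<lambda>n. (real n + 1) / real n) \<longlonglongrightarrow> 1" by real_asymp
  from tendsto_mult[OF tendsto_mult[OF lim tendsto_power[OF this, of "s + 1"]]
      tendsto_const[of "fact (s + 1) / P"]]
  have "(\<lambda>n. mean_occurrences A p n / (real n + 1) ^ (s + 1) * ((real n + 1) / real n) ^ (s + 1) *
      (fact (s + 1) / P)) \<longlonglongrightarrow> 1"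
    using \<open>P > 0\<close> by (simp del: fact_Suc add: field_simps)
  moreover have "mean_occurrences A p n / (real n + 1) ^ (s + 1) * ((real n + 1) / real n) ^ (s + 1) *
      (fact (s + 1) / P) = mean_occurrences A p n / (real n ^ (s + 1) / fact (s + 1) * P)" for n
  proof -
    have "(real n + 1) ^ (s + 1) \<noteq> 0" by (simp add: add_eq_0_iff)
    then show ?thesis by (simp add: power_divide del: power_Suc)
  qed
  ultimately show ?thesis
    by (intro asymp_equivI') (simp add: P_def N_def)
qed

end
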